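(* Consider a natural gas network on a connected directed graph $\mathcal{G}=(\mathcal{N},\mathcal{P})$ with lossy pipes $\bar{\mathcal{P}}_a$ and compressors $\mathcal{P}_a$, and suppose the gas flow problem is feasible. Let $\boldsymbol{\phi}$ be the flow vector of its unique solution, and let $\boldsymbol{\phi}'$ be the flow vector of a minimizer of the relaxed mixed-integer problem (G2). Assume: (1) there is a single fixed-pressure node, $\mathcal{N}_\psi=\{r\}$; (2) each edge of the network belongs to at most one cycle; (3) there is no circulation of gas: for every cycle $\mathcal{C}$ with indicator vector $\mathbf{n}^{\mathcal{C}}$, neither $n^{\mathcal{C}}_\ell\phi_\ell>0$ for all $\ell\in\mathcal{C}$ nor $n^{\mathcal{C}}_\ell\phi_\ell<0$ for all $\ell\in\mathcal{C}$. Then $\phi'_\ell=\phi_\ell$ for every edge $\ell\in\mathcal{P}$ that does not belong to an active cycle.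
   Context: Network. $\mathcal{G}=(\mathcal{N},\mathcal{P})$ is a finite directed graph, connected when edge directions are ignored, with $\mathcal{N}=\{1,\dots,N\}$ and $P$ edges; if $(m,n)\in\mathcal{P}$ then $(n,m)\notin\mathcal{P}$. The edge set is partitioned as $\mathcal{P}=\mathcal{P}_a\cup\bar{\mathcal{P}}_a$, with $\mathcal{P}_a$ the ideal compressors (factors $\alpha_\ell>0$) and $\bar{\mathcal{P}}_a$ the lossy pipes (coefficients $a_\ell>0$). The edge-node incidence matrix $\mathbf{A}\in\mathbb{R}^{P\times N}$ has, in the row of $\ell=(m,n)$, entry $+1$ in column $m$, $-1$ in column $n$, and $0$ elsewhere. Compressor convention. Every ideal compressor $(m,n)\in\mathcal{P}_a$ is followed by a lossy pipe: its head node $n$ is an internal junction node whose only incident edges are the compressor $(m,n)$ and one lossy pipe $(n,n')\in\bar{\mathcal{P}}_a$, and its injection is fixed to $q_n=0$. Cycles. A cycle is a closed sequence of adjacent edges (ignoring edge directions) without node or edge repetition. After choosing a traversal direction, its indicator vector $\mathbf{n}^{\mathcal{C}}\in\{0,\pm1\}^P$ has entry $0$ for $\ell\notin\mathcal{C}$, $+1$ if the direction of $\ell$ agrees with the cycle direction, and $-1$ otherwise. A cycle is active if it contains at least one compressor. Gas flow problem. The set $\mathcal{N}_\psi$ consists of the nodes with given pressures and $\mathcal{N}_q=\mathcal{N}\setminus\mathcal{N}_\psi$ of those with given injections. Find injections $\mathbf{q}\in\mathbb{R}^N$, flows $\boldsymbol{\phi}\in\mathbb{R}^P$ and (squared) pressures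 $\boldsymbol{\psi}\in\mathbb{R}^N$ agreeing with the given $\{\psi_n\}_{n\in\mathcal{N}_\psi}$, $\{q_n\}_{n\in\mathcal{N}_q}$ and such that: (i) $\mathbf{A}^\top\boldsymbol{\phi}=\mathbf{q}$; (ii) $\psi_m-\psi_n=a_\ell\,\mathrm{sign}(\phi_\ell)\phi_\ell^2$ for every $\ell=(m,n)\in\bar{\mathcal{P}}_a$, and $\psi_n\ge0$ for all $n$; (iii) $\psi_n=\alpha_\ell\psi_m$ and $\phi_\ell\ge0$ for every $\ell=(m,n)\in\mathcal{P}_a$. Problem (G2). Constants $\underline{\psi}_n\le\overline{\psi}_n$ (with $\underline\psi_n\ge 0$) and $\overline{\phi}_\ell$ are given bounds, valid for the gas flow solution: $\underline{\psi}_n\le\psi_n\le\overline{\psi}_n$ and $|\phi_\ell|\le\overline{\phi}_\ell$. With binary variables $x_\ell\in\{0,1\}$, $\ell\in\bar{\mathcal{P}}_a$, and auxiliary variables $z_{\ell m},z_{\ell n}$ for each $\ell=(m,n)\in\bar{\mathcal{P}}_a$, problem (G2) minimizes $$r(\boldsymbol{\psi})=\sum_{(m,n)}|\psi_m-\psi_n|,$$ the sum running over all lossy pipes $(m,n)\in\bar{\mathcal{P}}_a$ that belong to no active cycle, over $\mathbf{q},\boldsymbol{\phi},\boldsymbol{\psi},\mathbf{x}$ (and the $z$'s), with the given $\{\psi_n\}_{n\in\mathcal{N}_\psi}$, $\{q_n\}_{n\in\mathcal{N}_q}$ fixed, subject to (i), (iii), and for every $\ell=(m,n)\in\bar{\mathcal{P}}_a$: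 - for each endpoint $k\in\{m,n\}$: $x_\ell\underline{\psi}_k\le z_{\ell k}\le x_\ell\overline{\psi}_k$ and $\psi_k+(x_\ell-1)\overline{\psi}_k\le z_{\ell k}\le\psi_k+(x_\ell-1)\underline{\psi}_k$ (equivalently $z_{\ell k}=x_\ell\psi_k$ with $\underline\psi_k\le\psi_k\le\overline\psi_k$); - $2z_{\ell m}-2z_{\ell n}+\psi_n-\psi_m\ge a_\ell\phi_\ell^2$; - $-\overline{\phi}_\ell(1-x_\ell)\le\phi_\ell\le\overline{\phi}_\ell x_\ell$. *)

theory Defs
  imports Complex_Main "Graph_Theory.Graph_Theory"
begin

text \<open>
  Edges are ordered pairs of nodes, so an edge is \<open>e = (m, n)\<close> with \<open>m = fst e\<close> and
  \<open>n = snd e\<close>. Vectors indexed by nodes or edges are functions of which only the values on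
  the nodes or edges of the network matter.
  \<open>given_pressure\<close> is meaningful on \<open>pressure_nodes\<close> and \<open>given_injection\<close> on the
  remaining nodes. Pressures are squared pressures throughout.
\<close>

record 'v gas_network =
  network :: "'v pair_pre_digraph"
  compressors :: "('v \<times> 'v) set"
  compression :: "'v \<times> 'v \<Rightarrow> real"
  friction :: "'v \<times> 'v \<Rightarrow> real"
  pressure_nodes :: "'v set"
  given_pressure :: "'v \<Rightarrow> real"
  given_injection :: "'v \<Rightarrow> real"

definition nodes :: "'v gas_network \<Rightarrow> 'v set" where
  "nodes S = pverts (network S)"

definition edges :: "'v gas_network \<Rightarrow> ('v \<times> 'v) set" where
  "edges S = parcs (network S)"

definition lossy_pipes :: "'v gas_network \<Rightarrow> ('v \<times> 'v) set" where
  "lossy_pipes S = edges S - compressors S"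

definition incident_edges :: "'v gas_network \<Rightarrow> 'v \<Rightarrow> ('v \<times> 'v) set" where
  "incident_edges S k = {e \<in> edges S. fst e = k \<or> snd e = k}"

definition compressor_convention :: "'v gas_network \<Rightarrow> bool" where
  "compressor_convention S \<longleftrightarrow>
     (\<forall>(m, n) \<in> compressors S.
        (\<exists>n'. (n, n') \<in> lossy_pipes S \<and> incident_edges S n = {(m, n), (n, n')}) \<and>
        n \<notin> pressure_nodes S \<and> given_injection S n = 0)"

definition gas_network :: "'v gas_network \<Rightarrow> bool" where
  "gas_network S \<longleftrightarrow>
     pair_fin_digraph (network S) \<and>
     Digraph_Component.connected (with_proj (network S)) \<and>
     (\<forall>m n. (m, n) \<in> edges S \<longrightarrow> (n, m) \<notin> edges S) \<and>
     compressors S \<subseteq> edges S \<and>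
     (\<forall>e \<in> compressors S. compression S e > 0) \<and>
     (\<forall>e \<in> lossy_pipes S. friction S e > 0) \<and>
     pressure_nodes S \<subseteq> nodes S \<and>
     compressor_convention S"

text \<open>
  A cycle, together with a traversal direction, is a cycle of the underlying symmetric
  digraph; a library cycle there may be of the form \<open>[(u, v), (v, u)]\<close>, which
  would use one edge of the network twice and is excluded by the second conjunct.
  Different walks (other starting point, other direction) can describe the same cycle,
  so cycles are compared through their edge sets.
\<close>

definition is_cycle :: "'v gas_network \<Rightarrow> ('v \<times> 'v) awalk \<Rightarrow> bool" where
  "is_cycle S c \<longleftrightarrow>
     pre_digraph.cycle (with_proj (mk_symmetric (with_proj (network S)))) c \<and>
     (\<forall>e \<in> set c. prod.swap e \<notin> set c)"

definition cycle_edges :: "'v gas_network \<Rightarrow> ('v \<times> 'v) awalk \<Rightarrow> ('v \<times> 'v) set" where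
  "cycle_edges S c = {e \<in> edges S. e \<in> set c \<or> prod.swap e \<in> set c}"

definition cycle_indicator :: "'v gas_network \<Rightarrow> ('v \<times> 'v) awalk \<Rightarrow> 'v \<times> 'v \<Rightarrow> real" where
  "cycle_indicator S c e =
     (if e \<notin> cycle_edges S c then 0 else if e \<in> set c then 1 else - 1)"

definition active_cycle :: "'v gas_network \<Rightarrow> ('v \<times> 'v) awalk \<Rightarrow> bool" where
  "active_cycle S c \<longleftrightarrow> is_cycle S c \<and> cycle_edges S c \<inter> compressors S \<noteq> {}"

definition in_active_cycle :: "'v gas_network \<Rightarrow> 'v \<times> 'v \<Rightarrow> bool" where
  "in_active_cycle S e \<longleftrightarrow> (\<exists>c. active_cycle S c \<and> e \<in> cycle_edges S c)"

definition edges_in_at_most_one_cycle :: "'v gas_network \<Rightarrow> bool" where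
  "edges_in_at_most_one_cycle S \<longleftrightarrow>
     (\<forall>e \<in> edges S. \<forall>c c'. is_cycle S c \<and> e \<in> cycle_edges S c \<and>
        is_cycle S c' \<and> e \<in> cycle_edges S c' \<longrightarrow> cycle_edges S c = cycle_edges S c')"

definition no_circulation :: "'v gas_network \<Rightarrow> ('v \<times> 'v \<Rightarrow> real) \<Rightarrow> bool" where
  "no_circulation S \<phi> \<longleftrightarrow>
     (\<forall>c. is_cycle S c \<longrightarrow>
        \<not> (\<forall>e \<in> cycle_edges S c. cycle_indicator S c e * \<phi> e > 0) \<and>
        \<not> (\<forall>e \<in> cycle_edges S c. cycle_indicator S c e * \<phi> e < 0))"

text \<open>The matrix \<open>A\<close>; \<open>flow_balance\<close> is \<open>A\<^sup>T \<phi> = q\<close>.\<close>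

definition incidence :: "'v \<times> 'v \<Rightarrow> 'v \<Rightarrow> real" where
  "incidence e k = (if k = fst e then 1 else if k = snd e then - 1 else 0)"

definition flow_balance ::
  "'v gas_network \<Rightarrow> ('v \<Rightarrow> real) \<Rightarrow> ('v \<times> 'v \<Rightarrow> real) \<Rightarrow> bool" where
  "flow_balance S q \<phi> \<longleftrightarrow>
     (\<forall>k \<in> nodes S. (\<Sum>e \<in> edges S. incidence e k * \<phi> e) = q k)"

definition compressor_law ::
  "'v gas_network \<Rightarrow> ('v \<times> 'v \<Rightarrow> real) \<Rightarrow> ('v \<Rightarrow> real) \<Rightarrow> bool" where
  "compressor_law S \<phi> \<psi> \<longleftrightarrow>
     (\<forall>(m, n) \<in> compressors S. \<psi> n = compression S (m, n) * \<psi> m \<and> \<phi> (m, n) \<ge> 0)"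

definition agrees_with_data ::
  "'v gas_network \<Rightarrow> ('v \<Rightarrow> real) \<Rightarrow> ('v \<Rightarrow> real) \<Rightarrow> bool" where
  "agrees_with_data S q \<psi> \<longleftrightarrow>
     (\<forall>k \<in> pressure_nodes S. \<psi> k = given_pressure S k) \<and>
     (\<forall>k \<in> nodes S - pressure_nodes S. q k = given_injection S k)"

definition gas_flow_solution ::
  "'v gas_network \<Rightarrow> ('v \<Rightarrow> real) \<Rightarrow> ('v \<times> 'v \<Rightarrow> real) \<Rightarrow> ('v \<Rightarrow> real) \<Rightarrow> bool" where
  "gas_flow_solution S q \<phi> \<psi> \<longleftrightarrow>
     agrees_with_data S q \<psi> \<and>
     flow_balance S q \<phi> \<and>
     (\<forall>(m, n) \<in> lossy_pipes S.
        \<psi> m - \<psi> n = friction S (m, n) * sgn (\<phi> (m, n)) * (\<phi> (m, n))\<^sup>2) \<and>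
     (\<forall>k \<in> nodes S. \<psi> k \<ge> 0) \<and>
     compressor_law S \<phi> \<psi>"

text \<open>The arguments \<open>lo\<close>, \<open>up\<close> bound the pressures and \<open>cap\<close> bounds the flows.\<close>

definition valid_bounds ::
  "'v gas_network \<Rightarrow> ('v \<Rightarrow> real) \<Rightarrow> ('v \<Rightarrow> real) \<Rightarrow> ('v \<times> 'v \<Rightarrow> real) \<Rightarrow>
   ('v \<times> 'v \<Rightarrow> real) \<Rightarrow> ('v \<Rightarrow> real) \<Rightarrow> bool" where
  "valid_bounds S lo up cap \<phi> \<psi> \<longleftrightarrow>
     (\<forall>k \<in> nodes S. 0 \<le> lo k \<and> lo k \<le> up k) \<and>
     (\<forall>k \<in> nodes S. lo k \<le> \<psi> k \<and> \<psi> k \<le> up k) \<and>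
     (\<forall>e \<in> edges S. \<bar>\<phi> e\<bar> \<le> cap e)"

definition G2_objective :: "'v gas_network \<Rightarrow> ('v \<Rightarrow> real) \<Rightarrow> real" where
  "G2_objective S \<psi> =
     (\<Sum>(m, n) \<in> {e \<in> lossy_pipes S. \<not> in_active_cycle S e}. \<bar>\<psi> m - \<psi> n\<bar>)"

definition G2_feasible ::
  "'v gas_network \<Rightarrow> ('v \<Rightarrow> real) \<Rightarrow> ('v \<Rightarrow> real) \<Rightarrow> ('v \<times> 'v \<Rightarrow> real) \<Rightarrow>
   ('v \<Rightarrow> real) \<Rightarrow> ('v \<times> 'v \<Rightarrow> real) \<Rightarrow> ('v \<Rightarrow> real) \<Rightarrow> ('v \<times> 'v \<Rightarrow> real) \<Rightarrow>
   ('v \<times> 'v \<Rightarrow> 'v \<Rightarrow> real) \<Rightarrow> bool" where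
  "G2_feasible S lo up cap q \<phi> \<psi> x z \<longleftrightarrow>
     agrees_with_data S q \<psi> \<and>
     flow_balance S q \<phi> \<and>
     compressor_law S \<phi> \<psi> \<and>
     (\<forall>e \<in> lossy_pipes S. x e \<in> {0, 1}) \<and>
     (\<forall>e \<in> lossy_pipes S. \<forall>k \<in> {fst e, snd e}.
        x e * lo k \<le> z e k \<and> z e k \<le> x e * up k \<and>
        \<psi> k + (x e - 1) * up k \<le> z e k \<and> z e k \<le> \<psi> k + (x e - 1) * lo k) \<and>
     (\<forall>(m, n) \<in> lossy_pipes S.
        2 * z (m, n) m - 2 * z (m, n) n + \<psi> n - \<psi> m \<ge> friction S (m, n) * (\<phi> (m, n))\<^sup>2) \<and>
     (\<forall>e \<in> lossy_pipes S. - cap e * (1 - x e) \<le> \<phi> e \<and> \<phi> e \<le> cap e * x e)"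

definition G2_minimizer ::
  "'v gas_network \<Rightarrow> ('v \<Rightarrow> real) \<Rightarrow> ('v \<Rightarrow> real) \<Rightarrow> ('v \<times> 'v \<Rightarrow> real) \<Rightarrow>
   ('v \<Rightarrow> real) \<Rightarrow> ('v \<times> 'v \<Rightarrow> real) \<Rightarrow> ('v \<Rightarrow> real) \<Rightarrow> ('v \<times> 'v \<Rightarrow> real) \<Rightarrow>
   ('v \<times> 'v \<Rightarrow> 'v \<Rightarrow> real) \<Rightarrow> bool" where
  "G2_minimizer S lo up cap q \<phi> \<psi> x z \<longleftrightarrow>
     G2_feasible S lo up cap q \<phi> \<psi> x z \<and>
     (\<forall>q' \<phi>' \<psi>' x' z'. G2_feasible S lo up cap q' \<phi>' \<psi>' x' z' \<longrightarrow>
        G2_objective S \<psi> \<le> G2_objective S \<psi>')"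

end

theory Submission
  imports Defs
begin

text \<open>
  With one fixed-pressure node all injections are determined, so \<open>g = \<phi>' - \<phi>\<close> is a circulation.
  A circulation is nonzero only on edges lying on a cycle inside its support; when no edge is on two
  cycles, \<open>g\<close> therefore vanishes on bridges and is a multiple of the indicator on each cycle.
  Consequently \<open>sgn g\<close> is orthogonal to all potential drops on the pipes entering the objective,
  and adding \<open>\<Sum> sgn g * (\<psi>\<^sub>m - \<psi>\<^sub>n) = 0\<close> to the objective does not change it.
  After this shift the relaxed solution is at least as large as the gas flow solution on every pipe,
  strictly so where \<open>g \<noteq> 0\<close> and \<open>g \<phi> \<ge> 0\<close>. Minimality excludes such pipes; but if \<open>g \<phi> < 0\<close>
  wherever \<open>g \<noteq> 0\<close>, then \<open>\<Sum> sgn g * (\<psi>\<^sub>m - \<psi>\<^sub>n)\<close> is negative unless \<open>g = 0\<close>.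
\<close>

context
  fixes S :: "'v gas_network"
  assumes net: "gas_network S"
begin

section \<open>Incidence structure and summation by parts\<close>

lemma finite_nodes: "finite (nodes S)" and finite_edges: "finite (edges S)"
  using net pair_fin_digraph.pair_finite_verts[of "network S"]
    pair_fin_digraph.pair_finite_arcs[of "network S"]
  by (auto simp: gas_network_def nodes_def edges_def)

lemma edge_ends_in_nodes:
  assumes "e \<in> edges S"
  shows "fst e \<in> nodes S" and "snd e \<in> nodes S"
proof -
  interpret pair_fin_digraph "network S"
    using net by (simp add: gas_network_def)
  show "fst e \<in> nodes S" "snd e \<in> nodes S"
    using assms arc_fst_in_verts arc_snd_in_verts by (auto simp: nodes_def edges_def)
qed

lemma swap_notin_edges: "e \<in> edges S \<Longrightarrow> prod.swap e \<notin> edges S"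
  using net by (cases e) (auto simp: gas_network_def)

lemma edge_ends_distinct: "e \<in> edges S \<Longrightarrow> fst e \<noteq> snd e"
  using swap_notin_edges[of e] by (cases e) auto

lemma sum_incidence:
  assumes "e \<in> edges S"
  shows "(\<Sum>k \<in> nodes S. f k * incidence e k) = f (fst e) - f (snd e)"
proof -
  have "(\<Sum>k \<in> nodes S. f k * incidence e k) =
      (\<Sum>k \<in> {fst e, snd e}. f k * incidence e k)"
    using edge_ends_in_nodes[OF assms] finite_nodes
    by (intro sum.mono_neutral_right) (auto simp: incidence_def)
  then show ?thesis
    using edge_ends_distinct[OF assms] by (simp add: incidence_def)
qed

text \<open>The balance equations are paired with a node potential and the two sums exchanged. A
  constant \<open>f\<close> yields the total injection, the indicator of a node set the net flow
  across a cut.\<close>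

lemma summation_by_parts:
  assumes "flow_balance S b h"
  shows "(\<Sum>e \<in> edges S. (f (fst e) - f (snd e)) * h e) = (\<Sum>k \<in> nodes S. f k * b k)"
proof -
  have "(\<Sum>k \<in> nodes S. f k * b k) =
      (\<Sum>k \<in> nodes S. \<Sum>e \<in> edges S. f k * (incidence e k * h e))"
    using assms by (simp add: flow_balance_def flip: sum_distrib_left)
  also have "\<dots> = (\<Sum>e \<in> edges S. \<Sum>k \<in> nodes S. f k * (incidence e k * h e))"
    by (rule sum.swap)
  also have "\<dots> = (\<Sum>e \<in> edges S. (\<Sum>k \<in> nodes S. f k * incidence e k) * h e)"
    by (simp add: sum_distrib_right mult.assoc)
  also have "\<dots> = (\<Sum>e \<in> edges S. (f (fst e) - f (snd e)) * h e)"
    by (intro sum.cong) (simp_all add: sum_incidence)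
  finally show ?thesis by simp
qed

lemma total_injection_eq_0:
  assumes "flow_balance S q \<phi>"
  shows "(\<Sum>k \<in> nodes S. q k) = 0"
  using summation_by_parts[OF assms, of "\<lambda>_. 1"] by simp

section \<open>Cycles and their indicator vectors\<close>

lemma cycle_obtain:
  assumes "is_cycle S c"
  obtains u where "pcas u c u" and "distinct c" and "c \<noteq> []"
    and "\<And>e. e \<in> set c \<Longrightarrow> e \<in> edges S \<or> prod.swap e \<in> edges S"
    and "\<And>e. e \<in> set c \<Longrightarrow> prod.swap e \<notin> set c"
proof -
  let ?G = "mk_symmetric (with_proj (network S))"
  interpret N: pair_fin_digraph "network S"
    using net by (simp add: gas_network_def)
  interpret G: pair_fin_digraph ?G ..
  from assms obtain u where u: "G.awalk u c u" "distinct (tl (G.awalk_verts u c))" "c \<noteq> []"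
    by (auto simp: is_cycle_def G.cycle_def)
  have "distinct c"
    using u by (intro G.distinct_tl_verts_imp_distinct[of u c u]) auto
  moreover have "e \<in> edges S \<or> prod.swap e \<in> edges S" if "e \<in> set c" for e
    using u(1) that by (cases e) (fastforce simp: G.awalk_def parcs_mk_symmetric edges_def)
  ultimately show thesis
    using assms u by (intro that[of u]) (auto simp: G.awalk_def is_cycle_def)
qed

lemma pcas_telescope:
  fixes f :: "'v \<Rightarrow> real"
  assumes "pcas u c v"
  shows "(\<Sum>a \<leftarrow> c. f (fst a) - f (snd a)) = f u - f v"
  using assms by (induction c arbitrary: u) auto

text \<open>Differences of \<open>f\<close> telescope along the closed walk; the indicator
  compensates for edges traversed against their direction.\<close>

lemma sum_around_cycle:
  assumes "is_cycle S c"
  shows "(\<Sum>e \<in> cycle_edges S c. cycle_indicator S c e * (f (fst e) - f (snd e))) = 0"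
proof -
  obtain u where c: "pcas u c u" "distinct c"
    and sub: "\<And>e. e \<in> set c \<Longrightarrow> e \<in> edges S \<or> prod.swap e \<in> edges S"
    and anti: "\<And>e. e \<in> set c \<Longrightarrow> prod.swap e \<notin> set c"
    using cycle_obtain[OF assms] by metis
  \<comment> \<open>\<open>j\<close> sends a step of the walk to the network edge it uses. It is
    injective on the walk because no edge is traversed in both directions.\<close>
  define j where "j a = (if a \<in> edges S then a else prod.swap a)" for a
  have inj: "inj_on j (set c)"
  proof (rule inj_onI)
    fix a b assume "a \<in> set c" "b \<in> set c" "j a = j b"
    then show "a = b"
      using anti by (metis j_def swap_swap)
  qed
  have img: "j ` set c = cycle_edges S c"
  proof (intro equalityI subsetI)
    fix e assume "e \<in> cycle_edges S c"
    then show "e \<in> j ` set c"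
      using swap_notin_edges[of e]
      by (auto simp: cycle_edges_def j_def intro: image_eqI[of _ _ "prod.swap e"] image_eqI[of _ _ e])
  next
    fix e assume "e \<in> j ` set c"
    then show "e \<in> cycle_edges S c"
      using sub by (auto simp: cycle_edges_def j_def)
  qed
  have "(\<Sum>e \<in> cycle_edges S c. cycle_indicator S c e * (f (fst e) - f (snd e))) =
      (\<Sum>a \<in> set c. cycle_indicator S c (j a) * (f (fst (j a)) - f (snd (j a))))"
    unfolding img[symmetric] by (rule sum.reindex[OF inj, unfolded comp_def])
  also have "\<dots> = (\<Sum>a \<in> set c. f (fst a) - f (snd a))"
  proof (rule sum.cong[OF refl])
    fix a assume a: "a \<in> set c"
    then have "j a \<in> cycle_edges S c" by (auto simp flip: img)
    then show "cycle_indicator S c (j a) * (f (fst (j a)) - f (snd (j a))) = f (fst a) - f (snd a)"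
      using anti[OF a] a by (auto simp: cycle_indicator_def j_def)
  qed
  also have "\<dots> = 0"
    using pcas_telescope[OF c(1), of f] c(2) by (simp add: sum_list_distinct_conv_sum_set)
  finally show ?thesis .
qed

text \<open>The balance at \<open>k\<close> is the telescoping sum for the potential that is 1 at
  \<open>k\<close> and 0 elsewhere.\<close>

lemma cycle_indicator_flow_balance:
  assumes "is_cycle S c"
  shows "flow_balance S (\<lambda>_. 0) (cycle_indicator S c)"
  unfolding flow_balance_def
proof
  fix k
  let ?f = "\<lambda>v :: 'v. if v = k then 1 else 0 :: real"
  have "(\<Sum>e \<in> edges S. incidence e k * cycle_indicator S c e) =
      (\<Sum>e \<in> cycle_edges S c. incidence e k * cycle_indicator S c e)"
    using finite_edges
    by (intro sum.mono_neutral_right) (auto simp: cycle_indicator_def cycle_edges_def)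
  also have "\<dots> = (\<Sum>e \<in> cycle_edges S c. cycle_indicator S c e * (?f (fst e) - ?f (snd e)))"
    by (intro sum.cong) (auto simp: cycle_edges_def incidence_def dest: edge_ends_distinct)
  finally show "(\<Sum>e \<in> edges S. incidence e k * cycle_indicator S c e) = 0"
    using sum_around_cycle[OF assms, of ?f] by simp
qed

section \<open>Circulations and the cycles that carry them\<close>

lemma support_contains_cycle:
  assumes bal: "flow_balance S (\<lambda>_. 0) h" and e: "e \<in> edges S" "h e \<noteq> 0"
  obtains c where "is_cycle S c" and "e \<in> cycle_edges S c"
    and "\<And>e'. e' \<in> cycle_edges S c \<Longrightarrow> h e' \<noteq> 0"
proof -
  \<comment> \<open>Orient the support of \<open>h\<close> along the flow; by conservation no net flow leaves the set \<open>X\<close>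
    of nodes reachable from the end \<open>v\<close> of the oriented edge, so its start \<open>u\<close> lies in \<open>X\<close>.\<close>
  define D where "D = {(a, b). (a, b) \<in> edges S \<and> h (a, b) > 0 \<or> (b, a) \<in> edges S \<and> h (b, a) < 0}"
  define H where "H = \<lparr>pverts = nodes S, parcs = D\<rparr>"
  interpret H: pair_wf_digraph H
    using edge_ends_in_nodes by unfold_locales (force simp: H_def D_def)+
  have D_anti: "(b, a) \<notin> D" if "(a, b) \<in> D" for a b
    using that swap_notin_edges by (fastforce simp: D_def)
  have "(fst e, snd e) \<in> D \<or> (snd e, fst e) \<in> D"
    using e by (cases e) (auto simp: D_def neq_iff)
  then obtain u v where uv: "(u, v) \<in> D" "(u, v) = e \<or> (v, u) = e"
    by (metis prod.collapse)
  have vin: "v \<in> pverts H"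
    using uv H.arc_snd_in_verts[of "(u, v)"] by (simp add: H_def)
  define X where "X = {k. v \<rightarrow>\<^sup>*\<^bsub>with_proj H\<^esub> k}"
  have X_closed: "b \<in> X" if "a \<in> X" "(a, b) \<in> D" for a b
    using that H.reachable_adj_trans[of v a b] by (simp add: X_def H_def)
  have "v \<in> X"
    using vin by (auto simp: X_def)
  have "u \<in> X"
  proof (rule ccontr)
    assume "u \<notin> X"
    let ?f = "\<lambda>k. if k \<in> X then 1 else 0 :: real"
    \<comment> \<open>Each term is the flow that an edge carries out of \<open>X\<close>. No
      oriented edge leaves \<open>X\<close>, so no term is positive, while \<open>e\<close> carries
      flow from \<open>u\<close> into \<open>X\<close>.\<close>
    have term_le: "(?f (fst e') - ?f (snd e')) * h e' \<le> 0" if "e' \<in> edges S" for e'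
      using that X_closed[of "fst e'" "snd e'"] X_closed[of "snd e'" "fst e'"]
      by (cases e'; cases "h e' > 0"; cases "h e' < 0") (auto simp: D_def)
    have "(?f (fst e) - ?f (snd e)) * h e < 0"
      using uv \<open>u \<notin> X\<close> \<open>v \<in> X\<close> swap_notin_edges[OF e(1)] e(1) by (auto simp: D_def)
    then have "(\<Sum>e' \<in> edges S. (?f (fst e') - ?f (snd e')) * h e') < 0"
      using term_le e(1) finite_edges
        sum_strict_mono_ex1[of "edges S" "\<lambda>e'. (?f (fst e') - ?f (snd e')) * h e'" "\<lambda>_. 0"]
      by force
    then show False
      using summation_by_parts[OF bal, of ?f] by simp
  qed
  then obtain p where p: "H.apath v p u"
    by (auto simp: X_def H.reachable_apath)
  \<comment> \<open>The oriented edge closes the simple path from \<open>v\<close> to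
    \<open>u\<close>. Since \<open>D\<close> never contains both orientations of an edge,
    \<open>c\<close> uses no edge back and forth.\<close>
  define c where "c = (u, v) # p"
  have H_simps: "pverts H = nodes S" "parcs H = D"
    by (simp_all add: H_def)
  have sub: "set c \<subseteq> D"
    using p uv by (auto simp: c_def H.apath_def H.awalk_def H_simps)
  have "prod.swap a \<notin> D" if "a \<in> D" for a
    using D_anti that by (cases a) auto
  then have anti: "\<forall>a \<in> set c. prod.swap a \<notin> set c"
    using sub by blast
  let ?G = "mk_symmetric (with_proj (network S))"
  have "D \<subseteq> parcs ?G"
    by (auto simp: D_def edges_def parcs_mk_symmetric intro: bexI[rotated])
  then have "pre_digraph.awalk (with_proj ?G) u c u"
    using p sub uv vin H.arc_fst_in_verts[of "(u, v)"]
    by (auto simp: pre_digraph.awalk_def H.apath_def H.awalk_def c_def H_simps nodes_def cas_with_proj_eq)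
  moreover have "distinct (tl (pawalk_verts u c))"
    using p by (simp add: H.apath_def c_def)
  ultimately have "is_cycle S c"
    using anti by (auto simp: is_cycle_def pre_digraph.cycle_def awalk_verts_with_proj_eq c_def)
  moreover have "e \<in> cycle_edges S c"
    using uv e by (auto simp: cycle_edges_def c_def)
  moreover have "h e' \<noteq> 0" if "e' \<in> cycle_edges S c" for e'
    using that sub swap_notin_edges by (cases e') (fastforce simp: cycle_edges_def D_def)
  ultimately show thesis by (rule that)
qed


text \<open>Subtracting the multiple of the indicator that cancels \<open>g\<close> at one edge of
  \<open>c\<close> leaves a circulation. If it were nonzero elsewhere on \<open>c\<close>, it would
  be nonzero on a whole cycle through that edge; this can only be \<open>c\<close>, which contains
  the cancelled edge.\<close>

lemma circulation_on_cycle: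
  assumes one: "edges_in_at_most_one_cycle S"
    and g: "flow_balance S (\<lambda>_. 0) g" and c: "is_cycle S c"
  obtains t where "\<And>e. e \<in> cycle_edges S c \<Longrightarrow> g e = t * cycle_indicator S c e"
proof -
  have "cycle_edges S c \<noteq> {}"
  proof -
    obtain a where "a \<in> set c" "a \<in> edges S \<or> prod.swap a \<in> edges S"
      using cycle_obtain[OF c] by (metis list.set_intros(1) neq_Nil_conv)
    then have "a \<in> cycle_edges S c \<or> prod.swap a \<in> cycle_edges S c"
      by (auto simp: cycle_edges_def)
    then show ?thesis by blast
  qed
  then obtain e0 where e0: "e0 \<in> cycle_edges S c" by blast
  \<comment> \<open>The indicator is 1 or -1 at \<open>e0\<close>, so multiplying by it is the same
    as dividing by it.\<close>
  define t where "t = g e0 * cycle_indicator S c e0"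
  define h where "h e = g e - t * cycle_indicator S c e" for e
  have h0: "h e0 = 0"
    using e0 by (simp add: h_def t_def cycle_indicator_def)
  have "(\<Sum>e \<in> edges S. incidence e k * h e) = 0" if "k \<in> nodes S" for k
  proof -
    have "(\<Sum>e \<in> edges S. incidence e k * h e) = (\<Sum>e \<in> edges S. incidence e k * g e) -
        t * (\<Sum>e \<in> edges S. incidence e k * cycle_indicator S c e)"
      by (simp add: h_def algebra_simps sum_subtractf sum_distrib_left)
    then show ?thesis
      using g cycle_indicator_flow_balance[OF c] that by (simp add: flow_balance_def)
  qed
  then have h: "flow_balance S (\<lambda>_. 0) h"
    by (simp add: flow_balance_def)
  have "g e = t * cycle_indicator S c e" if e: "e \<in> cycle_edges S c" for e
  proof (rule ccontr)
    assume "g e \<noteq> t * cycle_indicator S c e"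
    moreover have "e \<in> edges S" using e by (simp add: cycle_edges_def)
    ultimately obtain c' where c': "is_cycle S c'" "e \<in> cycle_edges S c'"
      "\<And>e'. e' \<in> cycle_edges S c' \<Longrightarrow> h e' \<noteq> 0"
      using support_contains_cycle[OF h, of e] by (metis h_def right_minus_eq)
    then have "cycle_edges S c' = cycle_edges S c"
      using one c e \<open>e \<in> edges S\<close> unfolding edges_in_at_most_one_cycle_def by blast
    then show False
      using c'(3) e0 h0 by blast
  qed
  then show thesis by (rule that)
qed

lemma sum_sgn_circulation_drop:
  fixes f :: "'v \<Rightarrow> real"
  assumes one: "edges_in_at_most_one_cycle S"
    and g: "flow_balance S (\<lambda>_. 0) g"
  shows "(\<Sum>e \<in> {e \<in> lossy_pipes S. \<not> in_active_cycle S e}.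
    sgn (g e) * (f (fst e) - f (snd e))) = 0" (is "sum ?F ?L = 0")
proof -
  \<comment> \<open>\<open>K e\<close> is the cycle through \<open>e\<close>, or \<open>{e}\<close> if \<open>e\<close> is a bridge; these blocks partition the edges.\<close>
  define K where "K e = insert e (\<Union>c \<in> {c. is_cycle S c \<and> e \<in> cycle_edges S c}. cycle_edges S c)" for e
  have L_edges: "?L \<subseteq> edges S"
    by (auto simp: lossy_pipes_def)
  have K_cycle: "K e = cycle_edges S c" if "is_cycle S c" "e \<in> cycle_edges S c" for e c
  proof -
    have "e \<in> edges S" using that by (simp add: cycle_edges_def)
    then have eq: "cycle_edges S c' = cycle_edges S c"
      if "is_cycle S c'" "e \<in> cycle_edges S c'" for c'
      using one that \<open>is_cycle S c\<close> \<open>e \<in> cycle_edges S c\<close>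
      unfolding edges_in_at_most_one_cycle_def by blast
    show ?thesis
      unfolding K_def using that eq by blast
  qed
  have K_self: "e \<in> K e" for e
    by (simp add: K_def)
  have block: "sum ?F {e' \<in> ?L. K e' = K e} = 0" if e: "e \<in> ?L" for e
  proof (cases "\<exists>c. is_cycle S c \<and> e \<in> cycle_edges S c")
    case True
    then obtain c where c: "is_cycle S c" "e \<in> cycle_edges S c" by blast
    \<comment> \<open>The block must not be cut by the restriction to \<open>?L\<close>: the cycle
      \<open>c\<close> is not active, and it is the only cycle through any of its edges.\<close>
    have "cycle_edges S c \<subseteq> ?L"
    proof
      fix e' assume e': "e' \<in> cycle_edges S c"
      have "\<not> active_cycle S c"
        using c e by (auto simp: in_active_cycle_def)
      then have "e' \<in> lossy_pipes S"
        using e' c by (auto simp: active_cycle_def lossy_pipes_def cycle_edges_def)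
      moreover have "\<not> in_active_cycle S e'"
      proof
        assume "in_active_cycle S e'"
        then obtain c' where c': "active_cycle S c'" "e' \<in> cycle_edges S c'"
          by (auto simp: in_active_cycle_def)
        then have "cycle_edges S c' = cycle_edges S c"
          using K_cycle[of c' e'] K_cycle[of c e'] c e' by (simp add: active_cycle_def)
        then show False
          using c' \<open>\<not> active_cycle S c\<close> c by (simp add: active_cycle_def)
      qed
      ultimately show "e' \<in> ?L" by simp
    qed
    then have blk: "{e' \<in> ?L. K e' = K e} = cycle_edges S c"
      using K_cycle[OF c] K_cycle[OF c(1)] K_self by blast
    obtain t where t: "\<And>e'. e' \<in> cycle_edges S c \<Longrightarrow> g e' = t * cycle_indicator S c e'"
      using circulation_on_cycle[OF one g c(1)] by blast
    \<comment> \<open>The indicator is its own sign, so \<open>sgn (g e')\<close> is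
      \<open>sgn t\<close> times the indicator along \<open>c\<close>, which leaves a sum of
      potential drops around the cycle.\<close>
    have "sum ?F (cycle_edges S c) =
        (\<Sum>e' \<in> cycle_edges S c. sgn t * (cycle_indicator S c e' * (f (fst e') - f (snd e'))))"
    proof (rule sum.cong[OF refl])
      fix e' assume e': "e' \<in> cycle_edges S c"
      have "sgn (cycle_indicator S c e') = cycle_indicator S c e'"
        by (simp add: cycle_indicator_def)
      then show "?F e' = sgn t * (cycle_indicator S c e' * (f (fst e') - f (snd e')))"
        by (simp add: t[OF e'] sgn_mult)
    qed
    also have "\<dots> = 0"
      by (simp add: sum_around_cycle[OF c(1)] flip: sum_distrib_left)
    finally show ?thesis
      unfolding blk .
  next
    case False
    then have "K e = {e}" by (auto simp: K_def)
    then have "e' = e" if "K e' = K e" for e'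
      using K_self[of e'] that by simp
    then have "{e' \<in> ?L. K e' = K e} = {e}"
      using e by blast
    moreover have "g e = 0"
      using support_contains_cycle[OF g, of e] False e L_edges by blast
    ultimately show ?thesis by simp
  qed
  have "finite ?L"
    using finite_subset[OF L_edges finite_edges] .
  then have "sum ?F ?L = (\<Sum>B \<in> K ` ?L. sum ?F {e' \<in> ?L. K e' = B})"
    by (rule sum.image_gen)
  also have "\<dots> = 0"
    using block by (intro sum.neutral) blast
  finally show ?thesis .
qed

section \<open>The gas flow solution and the constraints of (G2)\<close>

text \<open>Only the injection at \<open>r\<close> is not prescribed, and the balance forces all
  injections to sum to 0.\<close>

lemma injections_unique:
  assumes "pressure_nodes S = {r}"
    and "agrees_with_data S q \<psi>" "flow_balance S q \<phi>"
    and "agrees_with_data S q' \<psi>'" "flow_balance S q' \<phi>'"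
    and "k \<in> nodes S"
  shows "q k = q' k"
proof -
  have r: "r \<in> nodes S"
    using net assms(1) by (auto simp: gas_network_def)
  have ne: "q j = q' j" if "j \<in> nodes S - {r}" for j
    using assms that by (simp add: agrees_with_data_def)
  have "q r = - sum q (nodes S - {r})" "q' r = - sum q' (nodes S - {r})"
    using total_injection_eq_0[OF assms(3)] total_injection_eq_0[OF assms(5)]
      sum.remove[OF finite_nodes r, of q] sum.remove[OF finite_nodes r, of q'] by simp_all
  moreover have "sum q (nodes S - {r}) = sum q' (nodes S - {r})"
    using ne by (rule sum.cong[OF refl])
  ultimately show ?thesis
    using ne[of k] assms(6) by (cases "k = r") auto
qed

text \<open>\<open>x e\<close> records the flow direction, so the relaxed inequality holds with
  equality by the pipe law. At zero flow the drop vanishes and the choice of 1 is arbitrary.\<close>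

lemma gas_flow_solution_G2_feasible:
  assumes sol: "gas_flow_solution S q \<phi> \<psi>" and bounds: "valid_bounds S lo up cap \<phi> \<psi>"
  defines "x \<equiv> \<lambda>e. if \<phi> e \<ge> 0 then 1 else 0"
  shows "G2_feasible S lo up cap q \<phi> \<psi> x (\<lambda>e k. x e * \<psi> k)"
proof -
  have x: "x e \<in> {0, 1}" for e
    by (simp add: x_def)
  have \<psi>: "lo k \<le> \<psi> k \<and> \<psi> k \<le> up k" if "k \<in> nodes S" for k
    using bounds that by (simp add: valid_bounds_def)
  have "- cap e * (1 - x e) \<le> \<phi> e \<and> \<phi> e \<le> cap e * x e" if "e \<in> lossy_pipes S" for e
  proof -
    have "\<bar>\<phi> e\<bar> \<le> cap e"
      using bounds that by (simp add: valid_bounds_def lossy_pipes_def)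
    then show ?thesis by (auto simp: x_def)
  qed
  moreover have "2 * (x (m, n) * \<psi> m) - 2 * (x (m, n) * \<psi> n) + \<psi> n - \<psi> m
      \<ge> friction S (m, n) * (\<phi> (m, n))\<^sup>2" if "(m, n) \<in> lossy_pipes S" for m n
  proof -
    have "\<psi> m - \<psi> n = friction S (m, n) * sgn (\<phi> (m, n)) * (\<phi> (m, n))\<^sup>2"
      using sol that by (auto simp: gas_flow_solution_def)
    then show ?thesis by (auto simp: x_def sgn_if split: if_splits)
  qed
  moreover have "x e * lo k \<le> x e * \<psi> k \<and> x e * \<psi> k \<le> x e * up k \<and>
      \<psi> k + (x e - 1) * up k \<le> x e * \<psi> k \<and> x e * \<psi> k \<le> \<psi> k + (x e - 1) * lo k"
    if "e \<in> lossy_pipes S" "k \<in> {fst e, snd e}" for e k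
    using that x[of e] \<psi>[of k] edge_ends_in_nodes[of e] by (auto simp: lossy_pipes_def)
  ultimately show ?thesis
    using sol x unfolding G2_feasible_def gas_flow_solution_def by blast
qed

end

text \<open>As \<open>x e\<close> is binary, the bounds on \<open>z\<close> force
  \<open>z e k = x e * \<psi> k\<close>, and the relaxed inequality bounds the drop from below in
  the direction chosen by \<open>x e\<close>. The flow bounds make this the direction of any nonzero
  flow.\<close>

lemma G2_feasible_drop:
  assumes "G2_feasible S lo up cap q \<phi> \<psi> x z" and "e \<in> lossy_pipes S"
  shows "\<phi> e > 0 \<Longrightarrow> \<psi> (fst e) - \<psi> (snd e) \<ge> friction S e * (\<phi> e)\<^sup>2"
    and "\<phi> e < 0 \<Longrightarrow> \<psi> (snd e) - \<psi> (fst e) \<ge> friction S e * (\<phi> e)\<^sup>2"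
    and "\<bar>\<psi> (fst e) - \<psi> (snd e)\<bar> \<ge> friction S e * (\<phi> e)\<^sup>2"
proof -
  obtain m n where e: "e = (m, n)" by (cases e)
  have x: "x e = 0 \<or> x e = 1"
    and ends: "\<forall>k \<in> {m, n}. x e * lo k \<le> z e k \<and> z e k \<le> x e * up k \<and>
        \<psi> k + (x e - 1) * up k \<le> z e k \<and> z e k \<le> \<psi> k + (x e - 1) * lo k"
    and drop: "2 * z e m - 2 * z e n + \<psi> n - \<psi> m \<ge> friction S e * (\<phi> e)\<^sup>2"
    and cap: "- cap e * (1 - x e) \<le> \<phi> e" "\<phi> e \<le> cap e * x e"
    using assms unfolding G2_feasible_def e by fastforce+
  show "\<phi> e > 0 \<Longrightarrow> \<psi> (fst e) - \<psi> (snd e) \<ge> friction S e * (\<phi> e)\<^sup>2"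
    and "\<phi> e < 0 \<Longrightarrow> \<psi> (snd e) - \<psi> (fst e) \<ge> friction S e * (\<phi> e)\<^sup>2"
    and "\<bar>\<psi> (fst e) - \<psi> (snd e)\<bar> \<ge> friction S e * (\<phi> e)\<^sup>2"
    using x ends drop cap by (auto simp: e)
qed

text \<open>For \<open>f' > f\<close> the shifted term is twice the positive part of the drop: it is
  0 on the left if \<open>f < 0\<close>, and otherwise it grows strictly with the flow. The case
  \<open>f' < f\<close> is the mirror image with negative parts.\<close>

lemma G2_drop_comparison:
  fixes a f f' d d' :: real
  assumes a: "a > 0" and d: "d = a * sgn f * f\<^sup>2"
    and pos: "f' > 0 \<Longrightarrow> d' \<ge> a * f'\<^sup>2" and neg: "f' < 0 \<Longrightarrow> - d' \<ge> a * f'\<^sup>2"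
    and abs: "\<bar>d'\<bar> \<ge> a * f'\<^sup>2"
  shows "\<bar>d\<bar> + sgn (f' - f) * d \<le> \<bar>d'\<bar> + sgn (f' - f) * d'"
    and "f' \<noteq> f \<Longrightarrow> (f' - f) * f \<ge> 0 \<Longrightarrow>
      \<bar>d\<bar> + sgn (f' - f) * d < \<bar>d'\<bar> + sgn (f' - f) * d'"
proof -
  have up: "\<bar>d\<bar> + d < \<bar>d'\<bar> + d'" if "f \<ge> 0" "f' > f"
  proof -
    have "a * f\<^sup>2 < a * f'\<^sup>2"
      using that a by (simp add: power_strict_mono)
    moreover have "d = a * f\<^sup>2" using d that by (auto simp: sgn_if)
    moreover have "d' \<ge> a * f'\<^sup>2" using pos that by simp
    moreover have "a * f\<^sup>2 \<ge> 0" using a by simp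
    ultimately show ?thesis by linarith
  qed
  have down: "\<bar>d\<bar> - d < \<bar>d'\<bar> - d'" if "f \<le> 0" "f' < f"
  proof -
    have "f\<^sup>2 < f'\<^sup>2"
      using that power_strict_mono[of "- f" "- f'" 2] by simp
    then have "a * f\<^sup>2 < a * f'\<^sup>2" using a by simp
    moreover have "d = - (a * f\<^sup>2)" using d that by (auto simp: sgn_if)
    moreover have "- d' \<ge> a * f'\<^sup>2" using neg that by simp
    moreover have "a * f\<^sup>2 \<ge> 0" using a by simp
    ultimately show ?thesis by linarith
  qed
  have d_neg: "d \<le> 0" if "f < 0" using d that a by (simp add: sgn_if)
  have d_pos: "d \<ge> 0" if "f > 0" using d that a by (simp add: sgn_if)
  have d_abs: "\<bar>d\<bar> = a * f\<^sup>2" using d a by (simp add: sgn_if abs_mult)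
  consider "f' = f" | "f' > f" "f \<ge> 0" | "f' > f" "f < 0" | "f' < f" "f \<le> 0" | "f' < f" "f > 0"
    by linarith
  then show "\<bar>d\<bar> + sgn (f' - f) * d \<le> \<bar>d'\<bar> + sgn (f' - f) * d'"
    by cases (use up down d_neg d_pos d_abs abs in auto)
  assume "f' \<noteq> f" "(f' - f) * f \<ge> 0"
  then consider "f' > f" "f \<ge> 0" | "f' < f" "f \<le> 0"
    by (auto simp: zero_le_mult_iff)
  then show "\<bar>d\<bar> + sgn (f' - f) * d < \<bar>d'\<bar> + sgn (f' - f) * d'"
    by cases (use up down in auto)
qed

section \<open>Minimality and equality of the flows\<close>

theorem theorem3:
  fixes S :: "'v gas_network" and r :: 'v
    and lo up :: "'v \<Rightarrow> real" and cap :: "'v \<times> 'v \<Rightarrow> real"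
    and q \<psi> q' \<psi>' :: "'v \<Rightarrow> real" and \<phi> \<phi>' x' :: "'v \<times> 'v \<Rightarrow> real"
    and z' :: "'v \<times> 'v \<Rightarrow> 'v \<Rightarrow> real"
  assumes "gas_network S"
    and "gas_flow_solution S q \<phi> \<psi>"
    and "valid_bounds S lo up cap \<phi> \<psi>"
    and "G2_minimizer S lo up cap q' \<phi>' \<psi>' x' z'"
    and "pressure_nodes S = {r}"
    and "edges_in_at_most_one_cycle S"
    and "no_circulation S \<phi>"
  shows "\<forall>e \<in> edges S. \<not> in_active_cycle S e \<longrightarrow> \<phi>' e = \<phi> e"
proof -
  define g where "g e = \<phi>' e - \<phi> e" for e
  define L where "L = {e \<in> lossy_pipes S. \<not> in_active_cycle S e}"
  define d where "d e = \<psi> (fst e) - \<psi> (snd e)" for e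
  define d' where "d' e = \<psi>' (fst e) - \<psi>' (snd e)" for e
  have feas: "G2_feasible S lo up cap q' \<phi>' \<psi>' x' z'"
    and min: "G2_objective S \<psi>' \<le> G2_objective S \<psi>"
    using assms(4) gas_flow_solution_G2_feasible[OF assms(1-3)]
    unfolding G2_minimizer_def by blast+
  have balances: "agrees_with_data S q \<psi>" "flow_balance S q \<phi>"
    "agrees_with_data S q' \<psi>'" "flow_balance S q' \<phi>'"
    using assms(2) feas by (auto simp: gas_flow_solution_def G2_feasible_def)
  have g: "flow_balance S (\<lambda>_. 0) g"
    using balances injections_unique[OF assms(1,5) balances]
    by (simp add: flow_balance_def g_def algebra_simps sum_subtractf)
  have finite_L: "finite L"
    using finite_edges[OF assms(1)] by (auto simp: L_def lossy_pipes_def)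
  have friction: "friction S e > 0" and drop: "d e = friction S e * sgn (\<phi> e) * (\<phi> e)\<^sup>2"
    if "e \<in> L" for e
    using assms(1,2) that
    by (auto simp: L_def gas_network_def gas_flow_solution_def d_def split: prod.splits)
  have cmp: "\<bar>d e\<bar> + sgn (g e) * d e \<le> \<bar>d' e\<bar> + sgn (g e) * d' e"
    and cmp_strict: "g e \<noteq> 0 \<Longrightarrow> g e * \<phi> e \<ge> 0 \<Longrightarrow>
      \<bar>d e\<bar> + sgn (g e) * d e < \<bar>d' e\<bar> + sgn (g e) * d' e" if "e \<in> L" for e
    using G2_drop_comparison[OF friction[OF that] drop[OF that], of "\<phi>' e" "d' e"]
      G2_feasible_drop[OF feas, of e] that
    by (auto simp: g_def d'_def L_def)
  have orth: "(\<Sum>e \<in> L. sgn (g e) * d e) = 0" "(\<Sum>e \<in> L. sgn (g e) * d' e) = 0"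
    using sum_sgn_circulation_drop[OF assms(1,6) g] by (simp_all add: L_def d_def d'_def)
  have "(\<Sum>e \<in> L. \<bar>d' e\<bar> + sgn (g e) * d' e) \<le> (\<Sum>e \<in> L. \<bar>d e\<bar> + sgn (g e) * d e)"
    using min orth by (simp add: sum.distrib G2_objective_def L_def d_def d'_def case_prod_beta)
  \<comment> \<open>The termwise inequalities \<open>cmp\<close> point the other way, so a single
    strict one would contradict the inequality of the sums.\<close>
  then have not_strict: "\<not> (g e \<noteq> 0 \<and> g e * \<phi> e \<ge> 0)" if "e \<in> L" for e
    using sum_strict_mono_ex1[OF finite_L, of "\<lambda>e. \<bar>d e\<bar> + sgn (g e) * d e"
      "\<lambda>e. \<bar>d' e\<bar> + sgn (g e) * d' e"] cmp cmp_strict[OF that] that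
    by (meson not_le)
  \<comment> \<open>Where \<open>g e\<close> is nonzero it now has the sign opposite to
    \<open>\<phi> e\<close>, so the product is \<open>- friction S e * (\<phi> e)\<^sup>2\<close>
    with nonzero flow.\<close>
  have le: "sgn (g e) * d e \<le> 0" and less: "g e \<noteq> 0 \<Longrightarrow> sgn (g e) * d e < 0"
    if "e \<in> L" for e
    using not_strict[OF that] friction[OF that] drop[OF that]
    by (auto simp: sgn_if mult_less_0_iff zero_le_mult_iff split: if_splits)
  have L0: "g e = 0" if "e \<in> L" for e
  proof (rule ccontr)
    assume "g e \<noteq> 0"
    then have "(\<Sum>e \<in> L. sgn (g e) * d e) < (\<Sum>e \<in> L. 0)"
      using finite_L le less that by (intro sum_strict_mono_ex1) blast+
    then show False
      using orth(1) by simp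
  qed
  show ?thesis
  proof (intro ballI impI)
    fix e assume e: "e \<in> edges S" "\<not> in_active_cycle S e"
    have "g e = 0"
    proof (cases "e \<in> compressors S")
      case True
      \<comment> \<open>Any cycle through a compressor is active, so this compressor is a bridge,
        where a circulation vanishes.\<close>
      then have "\<not> (is_cycle S c \<and> e \<in> cycle_edges S c)" for c
        using e by (auto simp: in_active_cycle_def active_cycle_def)
      then show ?thesis
        using support_contains_cycle[OF assms(1) g e(1)] by blast
    next
      case False
      then show ?thesis
        using e L0 by (simp add: L_def lossy_pipes_def)
    qed
    then show "\<phi>' e = \<phi> e" by (simp add: g_def)
  qed
qed

end
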